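(* Assume that the BDF2 kernels $b^{(n)}_{n-k}$ are positive semi-definite (or that the sufficient condition $0<r_k\le\frac{3+\sqrt{17}}{2}$ for $2\le k\le N$ holds), and that $\kappa\le0$ in $\Omega$. Then the solution $u^n$ of the adaptive BDF2 scheme satisfies $$\|u^{n}\|\le\|u^{0}\|+2\sum_{k=1}^{n}\sum_{j=1}^{k}\theta_{k-j}^{(k)}\|f^j\|\le\|u^{0}\|+2t_n\max_{1\le j\le n}\|f^j\|\qquad\text{for }1\le n\le N.$$ Thus the scheme is monotonicity-preserving: if $f^j=0$ for all $j$, then $\|u^n\|\le\|u^0\|$ for $1\le n\le N$.
   Context: Let $\Omega$ be a bounded convex domain with smooth boundary, $\varepsilon>0$ a constant, $\kappa=\kappa(x)$ a smooth bounded function on $\Omega$, $T>0$. $\langle\cdot,\cdot\rangle$ and $\|\cdot\|$ are the $L^2(\Omega)$ inner product and norm. Time mesh: $0=t_0<t_1<\cdots<t_N=T$, $\tau_k=t_k-t_{k-1}$ for $1\le k\le N$, $r_k=\tau_k/\tau_{k-1}$ for $2\le k\le N$. BDF2 kernels: $b^{(1)}_0=1/\tau_1$ and, for $2\le n\le N$, $$b^{(n)}_0=\frac{1+2r_n}{\tau_n(1+r_n)},\quad b^{(n)}_1=-\frac{r_n^2}{\tau_n(1+r_n)},\quad b^{(n)}_j=0\ \ (2\le j\le n-1).$$ They are called positive semi-definite if $\sum_{k=1}^nw_k\sum_{j=1}^kb_{k-j}^{(k)}w_j\ge0$ for every $1\le n\le N$ and all real $w_1,\dots,w_n$. BDF2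 operator: $D_2v^n=\sum_{k=1}^nb^{(n)}_{n-k}(v^k-v^{k-1})$ for $1\le n\le N$ (so the first step is BDF1). Discrete orthogonal convolution (DOC) kernels: for $1\le n\le N$, $$\theta_{0}^{(n)}=\frac{1}{b^{(n)}_{0}},\qquad \theta_{n-k}^{(n)}=-\frac{1}{b^{(k)}_{0}}\sum_{j=k+1}^{n}\theta_{n-j}^{(n)}b^{(j)}_{j-k}\quad(1\le k\le n-1).$$ Adaptive BDF2 scheme: given $u^0\in L^2(\Omega)$ and $f^n\in L^2(\Omega)$ for $1\le n\le N$, the functions $u^n\in H_0^1(\Omega)$, $1\le n\le N$, satisfy $$\langle D_2u^{n},w\rangle+\varepsilon\langle\nabla u^{n},\nabla w\rangle=\langle\kappa u^{n},w\rangle+\langle f^n,w\rangle\qquad\text{for all }w\in H_0^1(\Omega).$$ *)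

theory Defs
  imports "HOL-Analysis.Analysis"
begin

section \<open>Smooth functions and domains with smooth boundary\<close>

text \<open>\<open>Ck_on k S f\<close> and \<open>smooth_on S f\<close> are meant for open \<open>S\<close>: the derivatives are
  taken with respect to the full neighbourhood filter.\<close>

primrec Ck_on :: "nat \<Rightarrow> 'a::euclidean_space set \<Rightarrow> ('a \<Rightarrow> real) \<Rightarrow> bool" where
  "Ck_on 0 S f \<longleftrightarrow> continuous_on S f"
| "Ck_on (Suc k) S f \<longleftrightarrow> (\<forall>x\<in>S. f differentiable (at x)) \<and>
     (\<forall>v. Ck_on k S (\<lambda>x. frechet_derivative f (at x) v))"

definition smooth_on :: "'a::euclidean_space set \<Rightarrow> ('a \<Rightarrow> real) \<Rightarrow> bool" where
  "smooth_on S f \<longleftrightarrow> (\<forall>k. Ck_on k S f)"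

text \<open>Near each boundary point, an open set with smooth boundary is the sublevel set of a smooth
  function without critical points.\<close>

definition smooth_boundary :: "'a::euclidean_space set \<Rightarrow> bool" where
  "smooth_boundary \<Omega> \<longleftrightarrow> (\<forall>p\<in>frontier \<Omega>. \<exists>U \<rho>. open U \<and> p \<in> U \<and> smooth_on U \<rho> \<and>
     (\<forall>x\<in>U. frechet_derivative \<rho> (at x) \<noteq> (\<lambda>v. 0)) \<and> \<Omega> \<inter> U = {x\<in>U. \<rho> x < 0})"

section \<open>Function spaces\<close>

text \<open>Elements of \<open>L\<^sup>2(\<Omega>)\<close> are represented by functions rather than by equivalence classes
  modulo null sets; values outside \<open>\<Omega>\<close> are irrelevant. The codomain is \<open>real\<close> for
  scalar functions and the ambient space for gradients.\<close>

definition L2 :: "'a::euclidean_space set \<Rightarrow> ('a \<Rightarrow> 'b::euclidean_space) set" where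
  "L2 \<Omega> = {f \<in> borel_measurable (lebesgue_on \<Omega>). integrable (lebesgue_on \<Omega>) (\<lambda>x. (norm (f x))\<^sup>2)}"

definition L2_inner :: "'a::euclidean_space set \<Rightarrow> ('a \<Rightarrow> 'b::euclidean_space) \<Rightarrow> ('a \<Rightarrow> 'b) \<Rightarrow> real" where
  "L2_inner \<Omega> f g = (\<integral>x. f x \<bullet> g x \<partial>lebesgue_on \<Omega>)"

definition L2_norm :: "'a::euclidean_space set \<Rightarrow> ('a \<Rightarrow> 'b::euclidean_space) \<Rightarrow> real" where
  "L2_norm \<Omega> f = sqrt (L2_inner \<Omega> f f)"

definition test_function :: "'a::euclidean_space set \<Rightarrow> ('a \<Rightarrow> real) \<Rightarrow> bool" where
  "test_function \<Omega> \<phi> \<longleftrightarrow> smooth_on UNIV \<phi> \<and>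
     compact (closure {x. \<phi> x \<noteq> 0}) \<and> closure {x. \<phi> x \<noteq> 0} \<subseteq> \<Omega>"

definition weak_gradient :: "'a::euclidean_space set \<Rightarrow> ('a \<Rightarrow> real) \<Rightarrow> ('a \<Rightarrow> 'a) \<Rightarrow> bool" where
  "weak_gradient \<Omega> u g \<longleftrightarrow> (\<forall>\<phi>. test_function \<Omega> \<phi> \<longrightarrow> (\<forall>i\<in>Basis.
     (\<integral>x. u x * frechet_derivative \<phi> (at x) i \<partial>lebesgue_on \<Omega>)
       = - (\<integral>x. (g x \<bullet> i) * \<phi> x \<partial>lebesgue_on \<Omega>)))"

definition H1 :: "'a::euclidean_space set \<Rightarrow> ('a \<Rightarrow> real) set" where
  "H1 \<Omega> = {u \<in> L2 \<Omega>. \<exists>g\<in>L2 \<Omega>. weak_gradient \<Omega> u g}"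

text \<open>The weak gradient is unique only up to null sets. \<open>grad\<close> selects a representative;
  the integrals below do not depend on it.\<close>

definition grad :: "'a::euclidean_space set \<Rightarrow> ('a \<Rightarrow> real) \<Rightarrow> 'a \<Rightarrow> 'a" where
  "grad \<Omega> u = (SOME g. g \<in> L2 \<Omega> \<and> weak_gradient \<Omega> u g)"

definition H1_norm :: "'a::euclidean_space set \<Rightarrow> ('a \<Rightarrow> real) \<Rightarrow> real" where
  "H1_norm \<Omega> u = sqrt ((L2_norm \<Omega> u)\<^sup>2 + (L2_norm \<Omega> (grad \<Omega> u))\<^sup>2)"

text \<open>\<open>H\<^sub>0\<^sup>1(\<Omega>)\<close> is the closure of the test functions in \<open>H\<^sup>1(\<Omega>)\<close>.\<close>

definition H10 :: "'a::euclidean_space set \<Rightarrow> ('a \<Rightarrow> real) set" where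
  "H10 \<Omega> = {u \<in> H1 \<Omega>. \<forall>e>0. \<exists>\<phi>. test_function \<Omega> \<phi> \<and> H1_norm \<Omega> (\<lambda>x. u x - \<phi> x) < e}"

section \<open>Variable-step BDF2\<close>

definition time_mesh :: "(nat \<Rightarrow> real) \<Rightarrow> nat \<Rightarrow> real \<Rightarrow> bool" where
  "time_mesh t N T \<longleftrightarrow> t 0 = 0 \<and> t N = T \<and> (\<forall>k\<in>{1..N}. t (k - 1) < t k)"

definition step :: "(nat \<Rightarrow> real) \<Rightarrow> nat \<Rightarrow> real" where
  "step t k = t k - t (k - 1)"

definition step_ratio :: "(nat \<Rightarrow> real) \<Rightarrow> nat \<Rightarrow> real" where
  "step_ratio t k = step t k / step t (k - 1)"

text \<open>\<open>bdf2_kernel t n j\<close> is $b^{(n)}_j$, for \<open>j < n\<close>.\<close>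

definition bdf2_kernel :: "(nat \<Rightarrow> real) \<Rightarrow> nat \<Rightarrow> nat \<Rightarrow> real" where
  "bdf2_kernel t n j =
     (if n = 1 then (if j = 0 then 1 / step t 1 else 0)
      else if j = 0 then (1 + 2 * step_ratio t n) / (step t n * (1 + step_ratio t n))
      else if j = 1 then - (step_ratio t n)\<^sup>2 / (step t n * (1 + step_ratio t n))
      else 0)"

definition bdf2_pos_semidef :: "(nat \<Rightarrow> real) \<Rightarrow> nat \<Rightarrow> bool" where
  "bdf2_pos_semidef t N \<longleftrightarrow> (\<forall>n\<in>{1..N}. \<forall>w :: nat \<Rightarrow> real.
     0 \<le> (\<Sum>k=1..n. w k * (\<Sum>j=1..k. bdf2_kernel t k (k - j) * w j)))"

definition bdf2_op :: "(nat \<Rightarrow> real) \<Rightarrow> (nat \<Rightarrow> 'a \<Rightarrow> real) \<Rightarrow> nat \<Rightarrow> 'a \<Rightarrow> real" where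
  "bdf2_op t v n x = (\<Sum>k=1..n. bdf2_kernel t n (n - k) * (v k x - v (k - 1) x))"

text \<open>\<open>doc_kernel t n m\<close> is $\theta^{(n)}_m$, for \<open>m < n\<close>. The index \<open>k\<close> of the defining
  recursion is \<open>n - m\<close>.\<close>

function doc_kernel :: "(nat \<Rightarrow> real) \<Rightarrow> nat \<Rightarrow> nat \<Rightarrow> real" where
  "doc_kernel t n m =
     (if m = 0 then 1 / bdf2_kernel t n 0
      else if m < n then
        - (1 / bdf2_kernel t (n - m) 0) *
          (\<Sum>j = n - m + 1..n. doc_kernel t n (n - j) * bdf2_kernel t j (j - (n - m)))
      else 0)"
  by pat_completeness auto
termination
  by (relation "Wellfounded.measure (\<lambda>(t, n, m). m)") auto

declare doc_kernel.simps [simp del]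

definition adaptive_bdf2_solution ::
  "'a::euclidean_space set \<Rightarrow> real \<Rightarrow> ('a \<Rightarrow> real) \<Rightarrow> (nat \<Rightarrow> real) \<Rightarrow> nat \<Rightarrow>
    (nat \<Rightarrow> 'a \<Rightarrow> real) \<Rightarrow> (nat \<Rightarrow> 'a \<Rightarrow> real) \<Rightarrow> bool" where
  "adaptive_bdf2_solution \<Omega> \<epsilon> \<kappa> t N f u \<longleftrightarrow>
     (\<forall>n\<in>{1..N}. u n \<in> H10 \<Omega> \<and>
       (\<forall>w\<in>H10 \<Omega>. L2_inner \<Omega> (bdf2_op t u n) w + \<epsilon> * L2_inner \<Omega> (grad \<Omega> (u n)) (grad \<Omega> w)
          = L2_inner \<Omega> (\<lambda>x. \<kappa> x * u n x) w + L2_inner \<Omega> (f n) w))"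

end

theory Submission imports Defs begin

text \<open>The DOC kernels are the entries of the inverse of the lower triangular matrix of BDF2 kernels,
  so the \<open>\<theta>\<close>-weighted sum of the first \<open>k\<close> equations of the scheme, tested with \<open>u\<^sup>k\<close>, has the
  plain increment \<open>u\<^sup>k - u\<^sup>k\<^sup>-\<^sup>1\<close> in place of the BDF2 difference. Summing over \<open>k\<close>, the
  diffusion and reaction terms become quadratic forms in the DOC kernels, which inherit positive
  semi-definiteness from the BDF2 kernels, and can be dropped. The resulting energy inequality at
  the index where the norm of \<open>u\<^sup>k\<close> is maximal gives the first bound. The row sums of the DOC kernels
  are the time steps, because BDF2 differentiates \<open>t\<close> exactly; this gives the second.\<close>

lemma sum_triangle_swap:
  fixes g :: "nat \<Rightarrow> nat \<Rightarrow> 'b::comm_monoid_add"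
  shows "(\<Sum>j=1..n. \<Sum>l=1..j. g j l) = (\<Sum>l=1..n. \<Sum>j=l..n. g j l)"
proof -
  have "(\<Sum>j=1..n. \<Sum>l=1..j. g j l) = (\<Sum>j\<in>{1..n}. \<Sum>l\<in>{l\<in>{1..n}. l \<le> j}. g j l)"
    by (intro sum.cong) auto
  also have "\<dots> = (\<Sum>l\<in>{1..n}. \<Sum>j\<in>{j\<in>{1..n}. l \<le> j}. g j l)"
    by (rule sum.swap_restrict) auto
  also have "\<dots> = (\<Sum>l=1..n. \<Sum>j=l..n. g j l)"
    by (intro sum.cong) auto
  finally show ?thesis .
qed

section \<open>BDF2 and DOC kernels\<close>

lemma time_mesh_step_pos:
  assumes "time_mesh t N T" "1 \<le> k" "k \<le> N"
  shows "0 < step t k"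
  using assms by (auto simp: time_mesh_def step_def)

lemma time_mesh_ratio_pos:
  assumes "time_mesh t N T" "2 \<le> k" "k \<le> N"
  shows "0 < step_ratio t k"
  using time_mesh_step_pos[OF assms(1), of k] time_mesh_step_pos[OF assms(1), of "k - 1"] assms
  by (auto simp: step_ratio_def)

lemma bdf2_kernel_0_pos:
  assumes "time_mesh t N T" "1 \<le> n" "n \<le> N"
  shows "0 < bdf2_kernel t n 0"
proof (cases "n = 1")
  case True
  then show ?thesis using time_mesh_step_pos[OF assms] by (simp add: bdf2_kernel_def)
next
  case False
  then have "0 < step_ratio t n" using time_mesh_ratio_pos[OF assms(1), of n] assms by auto
  then show ?thesis
    using time_mesh_step_pos[OF assms] False by (auto simp: bdf2_kernel_def intro!: divide_pos_pos)
qed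

lemma bdf2_kernel_nonpos:
  assumes "time_mesh t N T" "1 \<le> n" "n \<le> N" "0 < j"
  shows "bdf2_kernel t n j \<le> 0"
proof (cases "n = 1")
  case True
  then show ?thesis using assms by (simp add: bdf2_kernel_def)
next
  case False
  then have "0 < step_ratio t n" using time_mesh_ratio_pos[OF assms(1), of n] assms by auto
  then show ?thesis
    using time_mesh_step_pos[OF assms(1-3)] False assms(4)
    by (auto simp: bdf2_kernel_def intro!: divide_nonneg_pos)
qed

lemma bdf2_kernel_sum:
  assumes "2 \<le> n"
  shows "(\<Sum>j=1..n. bdf2_kernel t n (n - j) * x j)
       = bdf2_kernel t n 0 * x n + bdf2_kernel t n 1 * x (n - 1)"
proof -
  have "(\<Sum>j=1..n. bdf2_kernel t n (n - j) * x j)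
      = (\<Sum>j\<in>{n - 1, n}. bdf2_kernel t n (n - j) * x j)"
    using assms by (intro sum.mono_neutral_right) (auto simp: bdf2_kernel_def)
  also have "\<dots> = bdf2_kernel t n 0 * x n + bdf2_kernel t n 1 * x (n - 1)"
    using assms by (subst sum.insert) auto
  finally show ?thesis .
qed

text \<open>This is the BDF2 difference of the function t itself: both the BDF1 first step and the
  later BDF2 steps are exact on linear functions.\<close>

lemma bdf2_kernel_sum_step:
  assumes "time_mesh t N T" "1 \<le> n" "n \<le> N"
  shows "(\<Sum>j=1..n. bdf2_kernel t n (n - j) * step t j) = 1"
proof (cases "n = 1")
  case True
  then show ?thesis
    using time_mesh_step_pos[OF assms] by (simp add: bdf2_kernel_def)
next
  case False
  then have n: "2 \<le> n" using assms by simp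
  define a b where "a = step t n" and "b = step t (n - 1)"
  have pos: "0 < a" "0 < b"
    unfolding a_def b_def using time_mesh_step_pos[OF assms(1)] n assms by auto
  have "(\<Sum>j=1..n. bdf2_kernel t n (n - j) * step t j)
      = (1 + 2 * (a / b)) / (a * (1 + a / b)) * a + - (a / b)\<^sup>2 / (a * (1 + a / b)) * b"
    using n by (subst bdf2_kernel_sum) (auto simp: bdf2_kernel_def step_ratio_def a_def b_def)
  \<comment> \<open>The factor a cancels; in the second term b / a is the reciprocal of the ratio
    and removes one of its two powers.\<close>
  also have "\<dots> = ((1 + 2 * (a / b)) - (a / b)) / (1 + a / b)"
    using pos by (simp add: power2_eq_square divide_simps)
  also have "\<dots> = 1"
    using pos by (simp add: divide_simps)
  finally show ?thesis .
qed

text \<open>Young's inequality with weight \<open>1/2\<close> makes the quadratic form telescope for all step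
  ratios up to \<open>4\<close>.\<close>

lemma bdf2_form_lower_bound:
  assumes mesh: "time_mesh t N T" and r4: "\<And>k. 2 \<le> k \<Longrightarrow> k \<le> N \<Longrightarrow> step_ratio t k \<le> 4"
    and "1 \<le> n" "n \<le> N"
  shows "(w n)\<^sup>2 / step t n \<le> (\<Sum>k=1..n. w k * (\<Sum>j=1..k. bdf2_kernel t k (k - j) * w j))"
  using assms(3,4)
proof (induction n rule: dec_induct)
  case base
  then show ?case by (simp add: bdf2_kernel_def power2_eq_square)
next
  case (step m)
  define a b r where "a = step t (Suc m)" and "b = step t m" and "r = step_ratio t (Suc m)"
  have pos: "0 < a" "0 < b" and r: "0 < r" "r \<le> 4"
    unfolding a_def b_def r_def
    using time_mesh_step_pos[OF mesh] time_mesh_ratio_pos[OF mesh, of "Suc m"] r4[of "Suc m"] step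
    by auto
  \<comment> \<open>This puts the telescoping difference over the denominator a: it equals (x^2 - r
    y^2) / a. After multiplication by a (1 + r), a polynomial inequality in r, x, y remains.\<close>
  have b: "b = a / r" using pos by (simp add: r_def step_ratio_def a_def b_def)
  define x y where "x = w (Suc m)" and "y = w m"
  have "r\<^sup>2 * (x * y) \<le> r\<^sup>2 * (x\<^sup>2 / 4 + y\<^sup>2)"
    using sum_squares_ge_zero[of "x / 2 - y" 0]
    by (intro mult_left_mono) (auto simp: power2_eq_square algebra_simps)
  \<comment> \<open>Here r \<le> 4 enters: the Young term r^2 x^2 / 4 fits into r x^2, the excess of
    (1 + 2 r) x^2 over (1 + r) x^2. On the y side a surplus r y^2 is left over.\<close>
  moreover have "r * (r * x\<^sup>2) \<le> r * (4 * x\<^sup>2)" "0 \<le> r * y\<^sup>2"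
    using r by (auto intro!: mult_left_mono mult_right_mono)
  ultimately have "(1 + r) * (x\<^sup>2 - r * y\<^sup>2) \<le> (1 + 2 * r) * x\<^sup>2 - r\<^sup>2 * (x * y)"
    by (simp add: power2_eq_square algebra_simps)
  then have "((1 + r) * (x\<^sup>2 - r * y\<^sup>2)) / (a * (1 + r))
      \<le> ((1 + 2 * r) * x\<^sup>2 - r\<^sup>2 * (x * y)) / (a * (1 + r))"
    using pos r by (intro divide_right_mono) auto
  moreover have "((1 + r) * (x\<^sup>2 - r * y\<^sup>2)) / (a * (1 + r)) = x\<^sup>2 / a - y\<^sup>2 / b"
    using r by (subst mult.commute[of a]) (simp add: b diff_divide_distrib mult.commute)
  moreover have "w (Suc m) * (\<Sum>j=1..Suc m. bdf2_kernel t (Suc m) (Suc m - j) * w j)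
      = ((1 + 2 * r) * x\<^sup>2 - r\<^sup>2 * (x * y)) / (a * (1 + r))"
  proof -
    have "bdf2_kernel t (Suc m) 0 = (1 + 2 * r) / (a * (1 + r))"
      "bdf2_kernel t (Suc m) 1 = - r\<^sup>2 / (a * (1 + r))"
      using step by (auto simp: bdf2_kernel_def a_def r_def)
    then show ?thesis
      using step pos r
      by (subst bdf2_kernel_sum)
        (auto simp: x_def y_def power2_eq_square diff_divide_distrib algebra_simps)
  qed
  ultimately have "x\<^sup>2 / a - y\<^sup>2 / b
      \<le> w (Suc m) * (\<Sum>j=1..Suc m. bdf2_kernel t (Suc m) (Suc m - j) * w j)"
    by simp
  moreover have "y\<^sup>2 / b \<le> (\<Sum>k=1..m. w k * (\<Sum>j=1..k. bdf2_kernel t k (k - j) * w j))"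
    using step by (simp add: y_def b_def)
  ultimately show ?case
    by (subst sum.cl_ivl_Suc) (simp add: x_def a_def del: sum.cl_ivl_Suc)
qed

lemma bdf2_pos_semidef_if_ratio_le:
  assumes mesh: "time_mesh t N T"
    and ratio: "\<forall>k\<in>{2..N}. step_ratio t k \<le> (3 + sqrt 17) / 2"
  shows "bdf2_pos_semidef t N"
  unfolding bdf2_pos_semidef_def
proof (intro ballI allI)
  fix n w assume n: "n \<in> {1..N}"
  \<comment> \<open>The crude bound 5 suffices, since (3 + 5) / 2 is exactly the admissible ratio
    4.\<close>
  have "sqrt 17 \<le> (5::real)" by (rule real_le_lsqrt) auto
  then have "step_ratio t k \<le> 4" if "2 \<le> k" "k \<le> N" for k
    using ratio that by force
  from bdf2_form_lower_bound[OF mesh this, of n w] n time_mesh_step_pos[OF mesh, of n]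
  show "0 \<le> (\<Sum>k=1..n. w k * (\<Sum>j=1..k. bdf2_kernel t k (k - j) * w j))"
    by (force intro: order_trans[rotated])
qed

section \<open>DOC kernels as the inverse of the BDF2 kernels\<close>

lemma doc_kernel_orthogonal:
  assumes "1 \<le> k" "k \<le> n" "bdf2_kernel t k 0 \<noteq> 0"
  shows "(\<Sum>j=k..n. doc_kernel t n (n - j) * bdf2_kernel t j (j - k)) = (if k = n then 1 else 0)"
proof (cases "k = n")
  case True
  then show ?thesis using assms by (simp add: doc_kernel.simps)
next
  case False
  \<comment> \<open>The defining recursion is the orthogonality relation solved for its term j =
    k.\<close>
  then have "doc_kernel t n (n - k) = - (1 / bdf2_kernel t k 0) *
      (\<Sum>j=k+1..n. doc_kernel t n (n - j) * bdf2_kernel t j (j - k))"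
    using assms by (subst doc_kernel.simps) auto
  moreover have "(\<Sum>j=k..n. doc_kernel t n (n - j) * bdf2_kernel t j (j - k))
      = doc_kernel t n (n - k) * bdf2_kernel t k 0
        + (\<Sum>j=k+1..n. doc_kernel t n (n - j) * bdf2_kernel t j (j - k))"
    using assms by (subst sum.atLeast_Suc_atMost) auto
  ultimately show ?thesis using assms False by simp
qed

text \<open>Left inverse property: after exchanging the sums, orthogonality leaves only the term l =
  n.\<close>

lemma doc_kernel_convolution:
  assumes mesh: "time_mesh t N T" and "1 \<le> n" "n \<le> N"
  shows "(\<Sum>j=1..n. doc_kernel t n (n - j) * (\<Sum>l=1..j. bdf2_kernel t j (j - l) * x l)) = x n"
proof -
  have "(\<Sum>j=1..n. doc_kernel t n (n - j) * (\<Sum>l=1..j. bdf2_kernel t j (j - l) * x l))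
      = (\<Sum>l=1..n. \<Sum>j=l..n. doc_kernel t n (n - j) * (bdf2_kernel t j (j - l) * x l))"
    unfolding sum_distrib_left by (rule sum_triangle_swap)
  also have "\<dots> = (\<Sum>l=1..n. (\<Sum>j=l..n. doc_kernel t n (n - j) * bdf2_kernel t j (j - l)) * x l)"
    by (simp add: sum_distrib_right mult.assoc)
  also have "\<dots> = (\<Sum>l=1..n. (if l = n then x l else 0))"
  proof (rule sum.cong)
    fix l assume "l \<in> {1..n}"
    then have "bdf2_kernel t l 0 \<noteq> 0" using bdf2_kernel_0_pos[OF mesh, of l] assms by auto
    with \<open>l \<in> {1..n}\<close> show "(\<Sum>j=l..n. doc_kernel t n (n - j) * bdf2_kernel t j (j - l)) * x l
        = (if l = n then x l else 0)"
      by (subst doc_kernel_orthogonal) auto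
  qed simp
  also have "\<dots> = x n" using assms by simp
  finally show ?thesis .
qed

text \<open>The minus sign in the recursion meets off-diagonal BDF2 kernels that are nonpositive,
  and the recursion only refers to smaller indices, so strong induction applies.\<close>

lemma doc_kernel_nonneg:
  assumes mesh: "time_mesh t N T" and "m < n" "n \<le> N"
  shows "0 \<le> doc_kernel t n m"
  using assms(2,3)
proof (induction m rule: less_induct)
  case (less m)
  show ?case
  proof (cases "m = 0")
    case True
    then show ?thesis
      using bdf2_kernel_0_pos[OF mesh, of n] less by (simp add: doc_kernel.simps)
  next
    case False
    have "0 \<le> - (doc_kernel t n (n - j) * bdf2_kernel t j (j - (n - m)))"
      if "j \<in> {n - m + 1..n}" for j
    proof -
      have "0 \<le> doc_kernel t n (n - j)" using that less by (intro less.IH) auto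
      moreover have "bdf2_kernel t j (j - (n - m)) \<le> 0"
        using that less by (intro bdf2_kernel_nonpos[OF mesh]) auto
      ultimately show ?thesis by (simp add: mult_nonneg_nonpos)
    qed
    then have "(\<Sum>j=n - m + 1..n. doc_kernel t n (n - j) * bdf2_kernel t j (j - (n - m))) \<le> 0"
      by (intro sum_nonpos) auto
    moreover have "0 < bdf2_kernel t (n - m) 0"
      using less by (intro bdf2_kernel_0_pos[OF mesh]) auto
    ultimately show ?thesis
      using False less by (subst doc_kernel.simps) (auto simp: divide_nonpos_pos)
  qed
qed

text \<open>The time steps solve the BDF2 system with right-hand side 1, so applying the DOC kernels
  to the constant 1 recovers them.\<close>

lemma doc_kernel_sum:
  assumes "time_mesh t N T" "1 \<le> n" "n \<le> N"
  shows "(\<Sum>j=1..n. doc_kernel t n (n - j)) = step t n"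
proof -
  have "(\<Sum>j=1..n. doc_kernel t n (n - j))
      = (\<Sum>j=1..n. doc_kernel t n (n - j) * (\<Sum>l=1..j. bdf2_kernel t j (j - l) * step t l))"
    using assms by (intro sum.cong refl) (auto simp: bdf2_kernel_sum_step simp del: One_nat_def)
  also have "\<dots> = step t n" using assms by (rule doc_kernel_convolution)
  finally show ?thesis .
qed

text \<open>Forward substitution in a lower triangular system with positive diagonal. It provides
  the vector v for the change of variables in the DOC quadratic form.\<close>

lemma bdf2_kernel_solve:
  assumes mesh: "time_mesh t N T" and "n \<le> N"
  shows "\<exists>v. \<forall>k\<in>{1..n}. (\<Sum>j=1..k. bdf2_kernel t k (k - j) * v j) = w k"
  using assms(2)
proof (induction n)
  case 0
  then show ?case by simp
next
  case (Suc n)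
  then obtain v where v: "\<forall>k\<in>{1..n}. (\<Sum>j=1..k. bdf2_kernel t k (k - j) * v j) = w k" by auto
  \<comment> \<open>The value that the last equation forces on the new unknown; earlier rows do not
    involve it.\<close>
  define c where "c = (w (Suc n) - (\<Sum>j=1..n. bdf2_kernel t (Suc n) (Suc n - j) * v j))
    / bdf2_kernel t (Suc n) 0"
  have "0 < bdf2_kernel t (Suc n) 0" using Suc by (intro bdf2_kernel_0_pos[OF mesh]) auto
  then have c: "(\<Sum>j=1..n. bdf2_kernel t (Suc n) (Suc n - j) * v j)
      + bdf2_kernel t (Suc n) 0 * c = w (Suc n)"
    by (simp add: c_def)
  have "(\<Sum>j=1..k. bdf2_kernel t k (k - j) * (v(Suc n := c)) j) = w k" if "k \<in> {1..Suc n}" for k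
  proof (cases "k = Suc n")
    case True
    then show ?thesis using c by simp
  next
    case False
    then have "(\<Sum>j=1..k. bdf2_kernel t k (k - j) * (v(Suc n := c)) j)
        = (\<Sum>j=1..k. bdf2_kernel t k (k - j) * v j)"
      using that by (intro sum.cong) auto
    then show ?thesis using v False that by simp
  qed
  then show ?case by blast
qed

text \<open>The DOC kernels invert the BDF2 kernels, and a matrix is positive semi-definite if and only
  if its inverse is.\<close>

lemma doc_kernel_pos_semidef:
  assumes mesh: "time_mesh t N T" and psd: "bdf2_pos_semidef t N" and "n \<le> N"
  shows "0 \<le> (\<Sum>k=1..n. w k * (\<Sum>j=1..k. doc_kernel t k (k - j) * w j))"
\<comment> \<open>\<open>bdf2_pos_semidef\<close> speaks only of n \<ge> 1; for n = 0 the sum is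
  empty.\<close>
proof (cases "n = 0")
  case False
  \<comment> \<open>With w the BDF2 image of v, the DOC kernels send w back to v, so the DOC form at
    w is the BDF2 form at v.\<close>
  obtain v where v: "\<forall>k\<in>{1..n}. (\<Sum>j=1..k. bdf2_kernel t k (k - j) * v j) = w k"
    using bdf2_kernel_solve[OF mesh assms(3)] by blast
  have "(\<Sum>k=1..n. w k * (\<Sum>j=1..k. doc_kernel t k (k - j) * w j))
      = (\<Sum>k=1..n. v k * (\<Sum>j=1..k. bdf2_kernel t k (k - j) * v j))"
  proof (rule sum.cong)
    fix k assume k: "k \<in> {1..n}"
    have "(\<Sum>j=1..k. doc_kernel t k (k - j) * w j)
        = (\<Sum>j=1..k. doc_kernel t k (k - j) * (\<Sum>l=1..j. bdf2_kernel t j (j - l) * v l))"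
      using v k by (intro sum.cong) auto
    also have "\<dots> = v k" using k assms by (intro doc_kernel_convolution[OF mesh]) auto
    finally show "w k * (\<Sum>j=1..k. doc_kernel t k (k - j) * w j)
        = v k * (\<Sum>j=1..k. bdf2_kernel t k (k - j) * v j)"
      using v k by simp
  qed simp
  then show ?thesis using psd False assms(3) by (auto simp: bdf2_pos_semidef_def)
qed simp

text \<open>Nonnegative kernels allow replacing each \<open>F j\<close> by M; the row sums are then
  time steps, which telescope.\<close>

lemma doc_kernel_double_sum_le:
  assumes mesh: "time_mesh t N T" and "n \<le> N" and M: "\<And>j. 1 \<le> j \<Longrightarrow> j \<le> n \<Longrightarrow> F j \<le> M"
  shows "(\<Sum>k=1..n. \<Sum>j=1..k. doc_kernel t k (k - j) * F j) \<le> t n * M"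
proof -
  have "(\<Sum>k=1..n. \<Sum>j=1..k. doc_kernel t k (k - j) * F j)
      \<le> (\<Sum>k=1..n. \<Sum>j=1..k. doc_kernel t k (k - j) * M)"
    using assms by (intro sum_mono mult_left_mono doc_kernel_nonneg[OF mesh]) auto
  also have "\<dots> = (\<Sum>k=1..n. step t k * M)"
    using assms
    by (intro sum.cong refl)
      (auto simp: doc_kernel_sum[OF mesh] sum_distrib_right[symmetric] simp del: One_nat_def)
  also have "\<dots> = (\<Sum>k=1..n. t k - t (k - 1)) * M"
    by (simp add: step_def sum_distrib_right)
  also have "(\<Sum>k=1..n. t k - t (k - 1)) = t n - t 0"
    by (induction n) auto
  also have "t 0 = 0" using mesh by (simp add: time_mesh_def)
  finally show ?thesis by simp
qed

section \<open>The space of square-integrable functions\<close>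

lemma L2_inner_integrable:
  assumes "f \<in> L2 \<Omega>" "g \<in> L2 \<Omega>"
  shows "integrable (lebesgue_on \<Omega>) (\<lambda>x. f x \<bullet> g x)"
proof (rule Bochner_Integration.integrable_bound)
  show "integrable (lebesgue_on \<Omega>) (\<lambda>x. (norm (f x))\<^sup>2 + (norm (g x))\<^sup>2)"
    using assms by (auto simp: L2_def)
  have [measurable]: "f \<in> borel_measurable (lebesgue_on \<Omega>)" "g \<in> borel_measurable (lebesgue_on \<Omega>)"
    using assms by (auto simp: L2_def)
  show "(\<lambda>x. f x \<bullet> g x) \<in> borel_measurable (lebesgue_on \<Omega>)" by measurable
  have "\<bar>f x \<bullet> g x\<bar> \<le> (norm (f x))\<^sup>2 + (norm (g x))\<^sup>2" for x
  proof -
    have "\<bar>f x \<bullet> g x\<bar> \<le> norm (f x) * norm (g x)" by (rule Cauchy_Schwarz_ineq2)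
    also have "\<dots> \<le> 2 * norm (f x) * norm (g x)" by simp
    also have "\<dots> \<le> (norm (f x))\<^sup>2 + (norm (g x))\<^sup>2" by (rule sum_squares_bound)
    finally show ?thesis .
  qed
  then show "AE x in lebesgue_on \<Omega>. norm (f x \<bullet> g x) \<le> norm ((norm (f x))\<^sup>2 + (norm (g x))\<^sup>2)"
    by simp
qed

lemma L2_diff:
  assumes "f \<in> L2 \<Omega>" "g \<in> L2 \<Omega>"
  shows "(\<lambda>x. f x - g x) \<in> L2 \<Omega>"
proof -
  have "integrable (lebesgue_on \<Omega>) (\<lambda>x. f x \<bullet> f x - 2 * (f x \<bullet> g x) + g x \<bullet> g x)"
    using assms by (intro Bochner_Integration.integrable_add Bochner_Integration.integrable_diff
        integrable_mult_right L2_inner_integrable) auto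
  then show ?thesis
    using assms by (auto simp: L2_def power2_norm_eq_inner inner_diff inner_commute algebra_simps)
qed

lemma L2_inner_self_nonneg: "0 \<le> L2_inner \<Omega> f f"
  unfolding L2_inner_def by (rule Bochner_Integration.integral_nonneg) simp

lemma L2_norm_nonneg: "0 \<le> L2_norm \<Omega> f"
  by (simp add: L2_norm_def L2_inner_self_nonneg)

lemma L2_norm_power2: "(L2_norm \<Omega> f)\<^sup>2 = L2_inner \<Omega> f f"
  by (simp add: L2_norm_def L2_inner_self_nonneg)

lemma L2_norm_eq_0:
  assumes "AE x in lebesgue_on \<Omega>. f x = 0"
  shows "L2_norm \<Omega> f = 0"
proof -
  have "L2_inner \<Omega> f f = 0"
    unfolding L2_inner_def by (rule integral_eq_zero_AE) (use assms in auto)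
  then show ?thesis by (simp add: L2_norm_def)
qed

lemma L2_inner_diff_left:
  assumes "f \<in> L2 \<Omega>" "g \<in> L2 \<Omega>" "h \<in> L2 \<Omega>"
  shows "L2_inner \<Omega> (\<lambda>x. f x - g x) h = L2_inner \<Omega> f h - L2_inner \<Omega> g h"
  using assms by (simp add: L2_inner_def inner_diff_left L2_inner_integrable)

text \<open>The expanded integral of |f - s g|^2. Different choices of s give Cauchy-Schwarz and the
  increment inequality.\<close>

lemma L2_inner_quadratic:
  assumes "f \<in> L2 \<Omega>" "g \<in> L2 \<Omega>"
  shows "0 \<le> L2_inner \<Omega> f f - 2 * s * L2_inner \<Omega> f g + s\<^sup>2 * L2_inner \<Omega> g g"
proof -
  have "0 \<le> (\<integral>x. (f x - s *\<^sub>R g x) \<bullet> (f x - s *\<^sub>R g x) \<partial>lebesgue_on \<Omega>)"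
    by (rule Bochner_Integration.integral_nonneg) simp
  also have "\<dots> = (\<integral>x. f x \<bullet> f x - 2 * s * (f x \<bullet> g x) + s\<^sup>2 * (g x \<bullet> g x) \<partial>lebesgue_on \<Omega>)"
    by (simp add: inner_diff inner_commute algebra_simps power2_eq_square)
  also have "\<dots> = L2_inner \<Omega> f f - 2 * s * L2_inner \<Omega> f g + s\<^sup>2 * L2_inner \<Omega> g g"
    using assms by (simp add: L2_inner_def L2_inner_integrable)
  finally show ?thesis .
qed

lemma L2_inner_le_norms:
  assumes "f \<in> L2 \<Omega>" "g \<in> L2 \<Omega>"
  shows "L2_inner \<Omega> f g \<le> L2_norm \<Omega> f * L2_norm \<Omega> g"
proof -
  let ?a = "L2_inner \<Omega> f f" and ?b = "L2_inner \<Omega> f g" and ?c = "L2_inner \<Omega> g g"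
  have q: "0 \<le> ?a - 2 * s * ?b + s\<^sup>2 * ?c" for s
    using assms by (rule L2_inner_quadratic)
  have "?b\<^sup>2 \<le> ?a * ?c"
  proof (cases "?c = 0")
    case True
    have "?b = 0"
    proof (rule ccontr)
      assume "?b \<noteq> 0"
      \<comment> \<open>For \<open>?c = 0\<close> the quadratic is linear in s, and this s makes its
        value -1.\<close>
      with q[of "(?a + 1) / (2 * ?b)"] True show False by simp
    qed
    then show ?thesis using True by simp
  next
    case False
    then have "0 < ?c" using L2_inner_self_nonneg[of \<Omega> g] by simp
    \<comment> \<open>The minimiser of the quadratic in s.\<close>
    with q[of "?b / ?c"] show ?thesis by (simp add: field_simps power2_eq_square)
  qed
  also have "\<dots> = (L2_norm \<Omega> f * L2_norm \<Omega> g)\<^sup>2"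
    by (simp add: power_mult_distrib L2_norm_power2)
  finally show ?thesis
    by (rule power2_le_imp_le) (simp add: L2_norm_nonneg)
qed

text \<open>The two sides differ by the squared norm of f - g, which is the quadratic at s =
  1.\<close>

lemma L2_inner_increment:
  assumes "f \<in> L2 \<Omega>" "g \<in> L2 \<Omega>"
  shows "(L2_norm \<Omega> f)\<^sup>2 - (L2_norm \<Omega> g)\<^sup>2 \<le> 2 * L2_inner \<Omega> (\<lambda>x. f x - g x) f"
proof -
  have "L2_inner \<Omega> g f = L2_inner \<Omega> f g" by (simp add: L2_inner_def inner_commute)
  then show ?thesis
    using L2_inner_quadratic[OF assms, of 1] assms
    by (simp add: L2_inner_diff_left L2_norm_power2)
qed

lemma L2_mult_bounded:
  fixes \<kappa> u :: "'a::euclidean_space \<Rightarrow> real"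
  assumes "open \<Omega>" "continuous_on \<Omega> \<kappa>" "bounded (\<kappa> ` \<Omega>)" "u \<in> L2 \<Omega>"
  shows "(\<lambda>x. \<kappa> x * u x) \<in> L2 \<Omega>"
proof -
  obtain B where B: "\<And>x. x \<in> \<Omega> \<Longrightarrow> \<bar>\<kappa> x\<bar> \<le> B"
    using assms(3) by (auto simp: bounded_iff)
  have [measurable]: "\<kappa> \<in> borel_measurable (lebesgue_on \<Omega>)"
    using assms by (intro continuous_imp_measurable_on_sets_lebesgue) auto
  have [measurable]: "u \<in> borel_measurable (lebesgue_on \<Omega>)"
    and u2: "integrable (lebesgue_on \<Omega>) (\<lambda>x. (norm (u x))\<^sup>2)"
    using assms by (auto simp: L2_def)
  have "integrable (lebesgue_on \<Omega>) (\<lambda>x. (norm (\<kappa> x * u x))\<^sup>2)"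
  proof (rule Bochner_Integration.integrable_bound)
    show "integrable (lebesgue_on \<Omega>) (\<lambda>x. B\<^sup>2 * (norm (u x))\<^sup>2)" using u2 by simp
    show "(\<lambda>x. (norm (\<kappa> x * u x))\<^sup>2) \<in> borel_measurable (lebesgue_on \<Omega>)" by measurable
    have "(\<kappa> x)\<^sup>2 \<le> B\<^sup>2" if "x \<in> \<Omega>" for x
      using power_mono[OF B[OF that], of 2] by simp
    then show "AE x in lebesgue_on \<Omega>.
        norm ((norm (\<kappa> x * u x))\<^sup>2) \<le> norm (B\<^sup>2 * (norm (u x))\<^sup>2)"
      using assms(1)
      by (intro AE_I2) (auto simp: power_mult_distrib abs_mult intro!: mult_right_mono)
  qed
  then show ?thesis by (simp add: L2_def)
qed

section \<open>Square-integrability of functions in \<open>H10\<close> and of their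
  gradients\<close>

lemma H10_in_L2: "u \<in> H10 \<Omega> \<Longrightarrow> u \<in> L2 \<Omega>"
  by (simp add: H10_def H1_def)

lemma H10_grad_in_L2:
  assumes "u \<in> H10 \<Omega>"
  shows "grad \<Omega> u \<in> L2 \<Omega>"
proof -
  have "\<exists>g. g \<in> L2 \<Omega> \<and> weak_gradient \<Omega> u g"
    using assms by (auto simp: H10_def H1_def)
  then show ?thesis unfolding grad_def by (rule someI2_ex) simp
qed

section \<open>Energy estimate\<close>

text \<open>For a fixed test function the scheme becomes a scalar BDF2 convolution, to which the DOC
  inversion applies.\<close>

lemma L2_inner_bdf2_op:
  assumes "\<And>k. k \<le> n \<Longrightarrow> u k \<in> L2 \<Omega>" "w \<in> L2 \<Omega>"
  shows "L2_inner \<Omega> (bdf2_op t u n) w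
      = (\<Sum>l=1..n. bdf2_kernel t n (n - l) * L2_inner \<Omega> (\<lambda>x. u l x - u (l - 1) x) w)"
proof -
  have "L2_inner \<Omega> (bdf2_op t u n) w
      = (\<integral>x. (\<Sum>l=1..n. bdf2_kernel t n (n - l) * ((u l x - u (l - 1) x) \<bullet> w x)) \<partial>lebesgue_on \<Omega>)"
    by (simp add: L2_inner_def bdf2_op_def sum_distrib_right mult.assoc)
  also have "\<dots> = (\<Sum>l=1..n. (\<integral>x. bdf2_kernel t n (n - l) * ((u l x - u (l - 1) x) \<bullet> w x)
      \<partial>lebesgue_on \<Omega>))"
    using assms
    by (intro Bochner_Integration.integral_sum integrable_mult_right L2_inner_integrable L2_diff)
      auto
  finally show ?thesis by (simp add: L2_inner_def)
qed

text \<open>Brings the double sums under one integral, so that signs can be checked pointwise in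
  x.\<close>

lemma L2_inner_double_sum:
  fixes n :: nat
  assumes "\<And>j. 1 \<le> j \<Longrightarrow> j \<le> n \<Longrightarrow> g j \<in> L2 \<Omega>" "\<And>k. 1 \<le> k \<Longrightarrow> k \<le> n \<Longrightarrow> h k \<in> L2 \<Omega>"
  shows "(\<Sum>k=1..n. \<Sum>j=1..k. c k j * L2_inner \<Omega> (g j) (h k))
      = (\<integral>x. (\<Sum>k=1..n. \<Sum>j=1..k. c k j * (g j x \<bullet> h k x)) \<partial>lebesgue_on \<Omega>)"
proof -
  have int: "integrable (lebesgue_on \<Omega>) (\<lambda>x. c k j * (g j x \<bullet> h k x))"
    if "k \<in> {1..n}" "j \<in> {1..k}" for k j
  proof -
    have "g j \<in> L2 \<Omega>" "h k \<in> L2 \<Omega>" using that by (auto intro!: assms)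
    then show ?thesis by (intro integrable_mult_right L2_inner_integrable)
  qed
  have "(\<integral>x. (\<Sum>k=1..n. \<Sum>j=1..k. c k j * (g j x \<bullet> h k x)) \<partial>lebesgue_on \<Omega>)
      = (\<Sum>k=1..n. (\<integral>x. (\<Sum>j=1..k. c k j * (g j x \<bullet> h k x)) \<partial>lebesgue_on \<Omega>))"
    by (intro Bochner_Integration.integral_sum Bochner_Integration.integrable_sum int)
  also have "\<dots> = (\<Sum>k=1..n. \<Sum>j=1..k. (\<integral>x. c k j * (g j x \<bullet> h k x) \<partial>lebesgue_on \<Omega>))"
    by (intro sum.cong refl Bochner_Integration.integral_sum int)
  finally show ?thesis by (simp add: L2_inner_def)
qed

text \<open>The form splits into one scalar DOC form per coordinate. The vector case is used for
  gradients.\<close>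

lemma doc_kernel_form_nonneg:
  fixes y :: "nat \<Rightarrow> 'b::euclidean_space"
  assumes "time_mesh t N T" "bdf2_pos_semidef t N" "n \<le> N"
  shows "0 \<le> (\<Sum>k=1..n. \<Sum>j=1..k. doc_kernel t k (k - j) * (y j \<bullet> y k))"
proof -
  have "(\<Sum>k=1..n. \<Sum>j=1..k. doc_kernel t k (k - j) * (y j \<bullet> y k))
      = (\<Sum>k=1..n. \<Sum>j=1..k. \<Sum>i\<in>Basis. (y k \<bullet> i) * (doc_kernel t k (k - j) * (y j \<bullet> i)))"
    by (subst euclidean_inner) (simp add: sum_distrib_left mult_ac)
  also have "\<dots> = (\<Sum>k=1..n. \<Sum>i\<in>Basis. \<Sum>j=1..k.
      (y k \<bullet> i) * (doc_kernel t k (k - j) * (y j \<bullet> i)))"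
    by (intro sum.cong refl sum.swap)
  also have "\<dots> = (\<Sum>i\<in>Basis. \<Sum>k=1..n. (y k \<bullet> i) * (\<Sum>j=1..k. doc_kernel t k (k - j) * (y j \<bullet> i)))"
    by (subst sum.swap) (simp add: sum_distrib_left)
  also have "\<dots> \<ge> 0"
    by (intro sum_nonneg doc_kernel_pos_semidef[OF assms])
  finally show ?thesis .
qed

text \<open>The index 0 is included because the maximal norm, at which the estimate is later
  applied, may occur there.\<close>

lemma adaptive_bdf2_energy:
  fixes \<Omega> :: "'a::euclidean_space set"
  assumes "open \<Omega>" "0 < \<epsilon>" "continuous_on \<Omega> \<kappa>" "bounded (\<kappa> ` \<Omega>)" "\<forall>x\<in>\<Omega>. \<kappa> x \<le> 0"
    and mesh: "time_mesh t N T" and psd: "bdf2_pos_semidef t N"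
    and u0: "u 0 \<in> L2 \<Omega>" and f: "\<forall>n\<in>{1..N}. f n \<in> L2 \<Omega>"
    and sol: "adaptive_bdf2_solution \<Omega> \<epsilon> \<kappa> t N f u"
    and n: "n \<le> N"
  shows "(L2_norm \<Omega> (u n))\<^sup>2 \<le> (L2_norm \<Omega> (u 0))\<^sup>2
    + 2 * (\<Sum>k=1..n. L2_norm \<Omega> (u k) * (\<Sum>j=1..k. doc_kernel t k (k - j) * L2_norm \<Omega> (f j)))"
proof -
  let ?\<theta> = "\<lambda>k j. doc_kernel t k (k - j)"
  let ?g = "\<lambda>j. grad \<Omega> (u j)"
  have H: "u k \<in> H10 \<Omega>" if "1 \<le> k" "k \<le> n" for k
    using sol that n by (auto simp: adaptive_bdf2_solution_def)
  have uL: "u k \<in> L2 \<Omega>" if "k \<le> n" for k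
    using H[of k] u0 that by (cases "k = 0") (auto intro: H10_in_L2)
  \<comment> \<open>All equations up to level k are tested with the same function
    \<open>u k\<close>, so that they can be combined with the DOC weights of row k.\<close>
  have eq: "(\<Sum>l=1..j. bdf2_kernel t j (j - l) * L2_inner \<Omega> (\<lambda>x. u l x - u (l - 1) x) (u k))
      = L2_inner \<Omega> (\<lambda>x. \<kappa> x * u j x) (u k) + L2_inner \<Omega> (f j) (u k)
        - \<epsilon> * L2_inner \<Omega> (?g j) (?g k)" if "k \<in> {1..n}" "j \<in> {1..k}" for k j
  proof -
    have "L2_inner \<Omega> (bdf2_op t u j) (u k) + \<epsilon> * L2_inner \<Omega> (?g j) (?g k)
          = L2_inner \<Omega> (\<lambda>x. \<kappa> x * u j x) (u k) + L2_inner \<Omega> (f j) (u k)"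
      using sol H[of k] that n by (auto simp: adaptive_bdf2_solution_def)
    moreover have "L2_inner \<Omega> (bdf2_op t u j) (u k)
        = (\<Sum>l=1..j. bdf2_kernel t j (j - l) * L2_inner \<Omega> (\<lambda>x. u l x - u (l - 1) x) (u k))"
      using that uL by (intro L2_inner_bdf2_op) auto
    ultimately show ?thesis by simp
  qed
  have incr: "L2_inner \<Omega> (\<lambda>x. u k x - u (k - 1) x) (u k)
      = (\<Sum>j=1..k. ?\<theta> k j * L2_inner \<Omega> (\<lambda>x. \<kappa> x * u j x) (u k))
        + (\<Sum>j=1..k. ?\<theta> k j * L2_inner \<Omega> (f j) (u k))
        - \<epsilon> * (\<Sum>j=1..k. ?\<theta> k j * L2_inner \<Omega> (?g j) (?g k))" if k: "k \<in> {1..n}" for k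
  proof -
    have "L2_inner \<Omega> (\<lambda>x. u k x - u (k - 1) x) (u k)
        = (\<Sum>j=1..k. ?\<theta> k j * (\<Sum>l=1..j. bdf2_kernel t j (j - l)
            * L2_inner \<Omega> (\<lambda>x. u l x - u (l - 1) x) (u k)))"
      using k n by (intro doc_kernel_convolution[OF mesh, symmetric]) auto
    also have "\<dots> = (\<Sum>j=1..k. ?\<theta> k j * (L2_inner \<Omega> (\<lambda>x. \<kappa> x * u j x) (u k)
        + L2_inner \<Omega> (f j) (u k) - \<epsilon> * L2_inner \<Omega> (?g j) (?g k)))"
      by (intro sum.cong refl) (simp only: eq[OF k])
    finally show ?thesis
      by (simp add: algebra_simps sum.distrib sum_subtractf sum_distrib_left)
  qed
  have G: "0 \<le> (\<Sum>k=1..n. \<Sum>j=1..k. ?\<theta> k j * L2_inner \<Omega> (?g j) (?g k))"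
    using H H10_grad_in_L2
    by (subst L2_inner_double_sum)
      (auto intro!: Bochner_Integration.integral_nonneg doc_kernel_form_nonneg[OF mesh psd n]
        simp del: One_nat_def)
  have K: "(\<Sum>k=1..n. \<Sum>j=1..k. ?\<theta> k j * L2_inner \<Omega> (\<lambda>x. \<kappa> x * u j x) (u k)) \<le> 0"
  proof -
    have "(\<Sum>k=1..n. \<Sum>j=1..k. ?\<theta> k j * L2_inner \<Omega> (\<lambda>x. \<kappa> x * u j x) (u k))
        = (\<integral>x. (\<Sum>k=1..n. \<Sum>j=1..k. ?\<theta> k j * ((\<kappa> x * u j x) \<bullet> u k x)) \<partial>lebesgue_on \<Omega>)"
      using uL assms(1-5) by (intro L2_inner_double_sum L2_mult_bounded) auto
    \<comment> \<open>At a fixed x the coefficient \<kappa> is a common factor of the whole double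
      sum; pulling out its nonpositive value leaves a DOC form in the scalars
      \<open>u j x\<close>.\<close>
    also have "\<dots> = (\<integral>x. - (- \<kappa> x * (\<Sum>k=1..n. \<Sum>j=1..k. ?\<theta> k j * (u j x \<bullet> u k x))) \<partial>lebesgue_on \<Omega>)"
      by (simp add: sum_distrib_left sum_negf mult_ac)
    also have "\<dots> = - (\<integral>x. (- \<kappa> x * (\<Sum>k=1..n. \<Sum>j=1..k. ?\<theta> k j * (u j x \<bullet> u k x))) \<partial>lebesgue_on \<Omega>)"
      by (rule Bochner_Integration.integral_minus)
    also have "\<dots> \<le> 0"
      unfolding neg_le_0_iff_le
    proof (rule Bochner_Integration.integral_nonneg)
      fix x assume "x \<in> space (lebesgue_on \<Omega>)"
      then have "0 \<le> - \<kappa> x" using assms(1,5) by simp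
      then show "0 \<le> - \<kappa> x * (\<Sum>k=1..n. \<Sum>j=1..k. ?\<theta> k j * (u j x \<bullet> u k x))"
        by (rule mult_nonneg_nonneg) (rule doc_kernel_form_nonneg[OF mesh psd n])
    qed
    finally show ?thesis .
  qed
  \<comment> \<open>Cauchy-Schwarz is applied termwise, which relies on the DOC kernels being
    nonnegative individually.\<close>
  have F: "(\<Sum>k=1..n. \<Sum>j=1..k. ?\<theta> k j * L2_inner \<Omega> (f j) (u k))
      \<le> (\<Sum>k=1..n. L2_norm \<Omega> (u k) * (\<Sum>j=1..k. ?\<theta> k j * L2_norm \<Omega> (f j)))"
    unfolding sum_distrib_left
  proof (intro sum_mono)
    fix k j assume kj: "k \<in> {1..n}" "j \<in> {1..k}"
    have "L2_inner \<Omega> (f j) (u k) \<le> L2_norm \<Omega> (f j) * L2_norm \<Omega> (u k)"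
      using kj f uL n by (intro L2_inner_le_norms) auto
    moreover have "0 \<le> ?\<theta> k j" using kj n by (intro doc_kernel_nonneg[OF mesh]) auto
    ultimately have "?\<theta> k j * L2_inner \<Omega> (f j) (u k)
        \<le> ?\<theta> k j * (L2_norm \<Omega> (f j) * L2_norm \<Omega> (u k))"
      by (rule mult_left_mono)
    then show "?\<theta> k j * L2_inner \<Omega> (f j) (u k) \<le> L2_norm \<Omega> (u k) * (?\<theta> k j * L2_norm \<Omega> (f j))"
      by (simp add: mult_ac)
  qed
  have "(L2_norm \<Omega> (u n))\<^sup>2 - (L2_norm \<Omega> (u 0))\<^sup>2
      = (\<Sum>k=1..n. (L2_norm \<Omega> (u k))\<^sup>2 - (L2_norm \<Omega> (u (k - 1)))\<^sup>2)"
    by (induction n) auto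
  also have "\<dots> \<le> (\<Sum>k=1..n. 2 * L2_inner \<Omega> (\<lambda>x. u k x - u (k - 1) x) (u k))"
    using uL by (intro sum_mono L2_inner_increment) auto
  also have "\<dots> = 2 * (\<Sum>k=1..n. L2_inner \<Omega> (\<lambda>x. u k x - u (k - 1) x) (u k))"
    by (simp add: sum_distrib_left)
  also have "(\<Sum>k=1..n. L2_inner \<Omega> (\<lambda>x. u k x - u (k - 1) x) (u k))
      = (\<Sum>k=1..n. (\<Sum>j=1..k. ?\<theta> k j * L2_inner \<Omega> (\<lambda>x. \<kappa> x * u j x) (u k))
        + (\<Sum>j=1..k. ?\<theta> k j * L2_inner \<Omega> (f j) (u k))
        - \<epsilon> * (\<Sum>j=1..k. ?\<theta> k j * L2_inner \<Omega> (?g j) (?g k)))"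
    by (intro sum.cong refl incr)
  also have "\<dots> = (\<Sum>k=1..n. \<Sum>j=1..k. ?\<theta> k j * L2_inner \<Omega> (\<lambda>x. \<kappa> x * u j x) (u k))
        + (\<Sum>k=1..n. \<Sum>j=1..k. ?\<theta> k j * L2_inner \<Omega> (f j) (u k))
        - \<epsilon> * (\<Sum>k=1..n. \<Sum>j=1..k. ?\<theta> k j * L2_inner \<Omega> (?g j) (?g k))"
    by (simp only: sum.distrib sum_subtractf sum_distrib_left)
  \<comment> \<open>The reaction sum \<open>K\<close> is nonpositive and the diffusion sum
    \<open>G\<close> enters with factor -\<epsilon>; both are dropped.\<close>
  also have "\<dots> \<le> (\<Sum>k=1..n. L2_norm \<Omega> (u k) * (\<Sum>j=1..k. ?\<theta> k j * L2_norm \<Omega> (f j)))"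
    using K F mult_nonneg_nonneg[OF less_imp_le[OF \<open>0 < \<epsilon>\<close>] G] by linarith
  finally show ?thesis by simp
qed

text \<open>Apply the hypothesis at an index where \<open>a\<close> is maximal and divide by that maximum.\<close>

lemma discrete_quadratic_gronwall:
  fixes a P :: "nat \<Rightarrow> real"
  assumes a: "\<And>k. 0 \<le> a k" and P: "\<And>k. 1 \<le> k \<Longrightarrow> k \<le> n \<Longrightarrow> 0 \<le> P k"
    and energy: "\<And>m. m \<le> n \<Longrightarrow> (a m)\<^sup>2 \<le> (a 0)\<^sup>2 + 2 * (\<Sum>k=1..m. a k * P k)"
  shows "a n \<le> a 0 + 2 * (\<Sum>k=1..n. P k)"
proof -
  have "Max (a ` {..n}) \<in> a ` {..n}" by (intro Max_in) auto
  then obtain m where m: "m \<le> n" "a m = Max (a ` {..n})" by (metis atMost_iff imageE)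
  have le: "a k \<le> a m" if "k \<le> n" for k
    unfolding m(2) using that by (intro Max_ge) auto
  have "(\<Sum>k=1..m. a k * P k) \<le> (\<Sum>k=1..m. a m * P k)"
    using m le P by (intro sum_mono mult_right_mono) auto
  also have "\<dots> \<le> (\<Sum>k=1..n. a m * P k)"
    using m(1) a P by (intro sum_mono2) (auto intro!: mult_nonneg_nonneg)
  finally have "(\<Sum>k=1..m. a k * P k) \<le> a m * (\<Sum>k=1..n. P k)"
    by (simp add: sum_distrib_left)
  \<comment> \<open>Gives every term of the energy bound the common factor
    \<open>a m\<close>.\<close>
  moreover have "(a 0)\<^sup>2 \<le> a m * a 0"
    using le[of 0] a[of 0] by (simp add: power2_eq_square mult_right_mono)
  ultimately have "a m * a m \<le> a m * (a 0 + 2 * (\<Sum>k=1..n. P k))"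
    using energy[OF m(1)] by (simp add: power2_eq_square algebra_simps)
  moreover have "0 \<le> (\<Sum>k=1..n. P k)" using P by (intro sum_nonneg) auto
  ultimately have "a m \<le> a 0 + 2 * (\<Sum>k=1..n. P k)"
    \<comment> \<open>If \<open>a m = 0\<close>, the claim is nonnegativity of the right-hand side;
      otherwise \<open>a m\<close> cancels.\<close>
    using a[of m] a[of 0] by (cases "a m = 0") auto
  with le[of n] show ?thesis by simp
qed

theorem theorem2p2:
  fixes \<Omega> :: "'a::euclidean_space set"
    and \<epsilon> T :: real
    and \<kappa> :: "'a \<Rightarrow> real"
    and t :: "nat \<Rightarrow> real"
    and N :: nat
    and f u :: "nat \<Rightarrow> 'a \<Rightarrow> real"
  assumes "open \<Omega>" "\<Omega> \<noteq> {}" "bounded \<Omega>" "convex \<Omega>" "smooth_boundary \<Omega>"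
    and "\<epsilon> > 0"
    and "smooth_on \<Omega> \<kappa>" "bounded (\<kappa> ` \<Omega>)"
    and "T > 0" "time_mesh t N T"
    and "u 0 \<in> L2 \<Omega>"
    and "\<forall>n\<in>{1..N}. f n \<in> L2 \<Omega>"
    and "adaptive_bdf2_solution \<Omega> \<epsilon> \<kappa> t N f u"
    and "bdf2_pos_semidef t N \<or>
      (\<forall>k\<in>{2..N}. 0 < step_ratio t k \<and> step_ratio t k \<le> (3 + sqrt 17) / 2)"
    and "\<forall>x\<in>\<Omega>. \<kappa> x \<le> 0"
  shows "(\<forall>n\<in>{1..N}.
      L2_norm \<Omega> (u n)
        \<le> L2_norm \<Omega> (u 0) + 2 * (\<Sum>k=1..n. \<Sum>j=1..k. doc_kernel t k (k - j) * L2_norm \<Omega> (f j)) \<and>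
      L2_norm \<Omega> (u 0) + 2 * (\<Sum>k=1..n. \<Sum>j=1..k. doc_kernel t k (k - j) * L2_norm \<Omega> (f j))
        \<le> L2_norm \<Omega> (u 0) + 2 * t n * Max ((\<lambda>j. L2_norm \<Omega> (f j)) ` {1..n})) \<and>
    ((\<forall>j\<in>{1..N}. AE x in lebesgue_on \<Omega>. f j x = 0) \<longrightarrow>
      (\<forall>n\<in>{1..N}. L2_norm \<Omega> (u n) \<le> L2_norm \<Omega> (u 0)))"
proof -
  note mesh = \<open>time_mesh t N T\<close>
  let ?F = "\<lambda>n. \<Sum>k=1..n. \<Sum>j=1..k. doc_kernel t k (k - j) * L2_norm \<Omega> (f j)"
  have psd: "bdf2_pos_semidef t N"
    using assms(14) bdf2_pos_semidef_if_ratio_le[OF mesh] by blast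
  have "Ck_on 0 \<Omega> \<kappa>" using assms(7) unfolding smooth_on_def by blast
  then have cont: "continuous_on \<Omega> \<kappa>" by simp
  have bound: "L2_norm \<Omega> (u n) \<le> L2_norm \<Omega> (u 0) + 2 * ?F n" if "n \<in> {1..N}" for n
  \<comment> \<open>The role of \<open>P k\<close> is taken by the inner DOC sum of row k, so the
    resulting bound is the double sum \<open>?F n\<close>.\<close>
  proof (rule discrete_quadratic_gronwall[where a = "\<lambda>k. L2_norm \<Omega> (u k)"])
    show "0 \<le> (\<Sum>j=1..k. doc_kernel t k (k - j) * L2_norm \<Omega> (f j))" if "1 \<le> k" "k \<le> n" for k
      using that \<open>n \<in> {1..N}\<close>
      by (intro sum_nonneg mult_nonneg_nonneg doc_kernel_nonneg[OF mesh] L2_norm_nonneg) auto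
    show "(L2_norm \<Omega> (u m))\<^sup>2 \<le> (L2_norm \<Omega> (u 0))\<^sup>2
      + 2 * (\<Sum>k=1..m. L2_norm \<Omega> (u k) * (\<Sum>j=1..k. doc_kernel t k (k - j) * L2_norm \<Omega> (f j)))"
      if "m \<le> n" for m
      using that \<open>n \<in> {1..N}\<close>
      by (intro adaptive_bdf2_energy[OF assms(1,6) cont assms(8,15) mesh psd assms(11-13)]) auto
  qed (rule L2_norm_nonneg)
  have "?F n \<le> t n * Max ((\<lambda>j. L2_norm \<Omega> (f j)) ` {1..n})" if "n \<in> {1..N}" for n
    using that by (intro doc_kernel_double_sum_le[OF mesh] Max_ge) auto
  moreover have "L2_norm \<Omega> (u n) \<le> L2_norm \<Omega> (u 0)"
    if zero: "\<forall>j\<in>{1..N}. AE x in lebesgue_on \<Omega>. f j x = 0" and n: "n \<in> {1..N}" for n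
  proof -
    have "?F n = 0" using zero n by (intro sum.neutral ballI) (auto intro: L2_norm_eq_0)
    with bound[OF n] show ?thesis by simp
  qed
  ultimately show ?thesis using bound by (auto simp: mult.assoc)
qed

end
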